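(* Let $p\ge2$ be a fixed integer. For any fixed integer $k\ge0$, $$\lim_{N\to\infty}\epsilon_k=0,$$ where $N$ ranges over the multiples of $p$ and $\epsilon_k=\mathbb{P}(1\notin A_k)$ is the probability that particle $1$ is not clean after $k$ random divisions of $\{1,\dots,N\}$ into batches of size $p$.
   Context: Let $N$ be divisible by $p$. For each $k\ge0$ let $\mathcal{C}^{(k)}$ be a uniformly random partition of $\{1,\dots,N\}$ into $N/p$ batches of size $p$, the partitions for different $k$ being independent. For each $i\in\{1,\dots,N\}$ set $L_i^{(0)}=\{i\}$ and, for $k\ge1$, $L_i^{(k)}=\bigcup_{j\in\mathcal{C}}L_j^{(k-1)}$, where $\mathcal{C}\in\mathcal{C}^{(k-1)}$ is the batch containing $i$. The random set $A_k$ of particles that are clean after $k$ divisions is defined by $A_0=\{1,\dots,N\}$ and, for $k\ge1$: $i\in A_k$ if and only if the batch $\mathcal{C}\in\mathcal{C}^{(k-1)}$ containing $i$ satisfies (1) every $j\in\mathcal{C}$ belongs to $A_{k-1}$, and (2) $L_j^{(k-1)}\cap L_\ell^{(k-1)}=\emptyset$ for all $j,\ell\in\mathcal{C}$ with $j\ne\ell$. Set $\epsilon_k:=\mathbb{P}(1\notin A_k)$, which depends on $N$. *)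

theory Defs
  imports "HOL-Probability.Probability" "HOL-Library.Disjoint_Sets"
begin

definition batch_partitions :: "nat \<Rightarrow> nat \<Rightarrow> nat set set set" where
  "batch_partitions p N = {P. partition_on {1..N} P \<and> (\<forall>B\<in>P. card B = p)}"

definition batch_of :: "nat set set \<Rightarrow> nat \<Rightarrow> nat set" where
  "batch_of P i = (THE B. B \<in> P \<and> i \<in> B)"

text \<open>
  The next two functions are deterministic: \<open>D k\<close> is a realisation of the partition
  used in the division that leads from step \<open>k\<close> to step \<open>k + 1\<close>.
\<close>

primrec lineage :: "(nat \<Rightarrow> nat set set) \<Rightarrow> nat \<Rightarrow> nat \<Rightarrow> nat set" where
  "lineage D 0 i = {i}"
| "lineage D (Suc k) i = (\<Union>j\<in>batch_of (D k) i. lineage D k j)"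

primrec clean :: "nat \<Rightarrow> (nat \<Rightarrow> nat set set) \<Rightarrow> nat \<Rightarrow> nat set" where
  "clean N D 0 = {1..N}"
| "clean N D (Suc k) = {i \<in> {1..N}.
     (\<forall>j\<in>batch_of (D k) i. j \<in> clean N D k) \<and>
     (\<forall>j\<in>batch_of (D k) i. \<forall>l\<in>batch_of (D k) i.
        j \<noteq> l \<longrightarrow> lineage D k j \<inter> lineage D k l = {})}"

locale random_divisions = prob_space M for M :: "'a measure" +
  fixes p N :: nat and C :: "nat \<Rightarrow> 'a \<Rightarrow> nat set set"
  assumes indep: "indep_vars (\<lambda>_. count_space (batch_partitions p N)) C UNIV"
    and uniform: "\<And>k. distr M (count_space (batch_partitions p N)) (C k)
                     = uniform_count_measure (batch_partitions p N)"

definition dirty_prob :: "'a measure \<Rightarrow> nat \<Rightarrow> (nat \<Rightarrow> 'a \<Rightarrow> nat set set) \<Rightarrow> nat \<Rightarrow> real" where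
  "dirty_prob M N C k = measure M {\<omega> \<in> space M. 1 \<notin> clean N (\<lambda>n. C n \<omega>) k}"

lemma finite_batch_partitions: "finite (batch_partitions p N)"
proof (rule finite_subset)
  show "batch_partitions p N \<subseteq> Pow (Pow {1..N})"
    by (auto simp: batch_partitions_def partition_on_def)
qed simp

lemma batch_partitions_nonempty:
  assumes "p > 0" "p dvd N"
  shows "batch_partitions p N \<noteq> {}"
proof -
  obtain m where N: "N = p * m" using assms by blast
  have "batch_partitions p (p * m) \<noteq> {}"
  proof (induction m)
    case 0
    have "{} \<in> batch_partitions p 0" by (simp add: batch_partitions_def partition_on_empty)
    then show ?case by auto
  next
    case (Suc m)
    then obtain P where P: "P \<in> batch_partitions p (p * m)" by blast
    have part: "partition_on {1..p * m} P" using P by (simp add: batch_partitions_def)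
    then have Un: "\<Union>P = {1..p * m}" by (simp add: partition_on_def)
    have diff: "{1..p * Suc m} - {p * m + 1..p * m + p} = {1..p * m}" by auto
    have "disjnt {p * m + 1..p * m + p} (\<Union>P)" unfolding Un by (auto simp: disjnt_def)
    then have "partition_on {1..p * Suc m} (insert {p * m + 1..p * m + p} P)"
      using part \<open>p > 0\<close> by (auto simp only: partition_on_insert diff) auto
    then have "insert {p * m + 1..p * m + p} P \<in> batch_partitions p (p * Suc m)"
      using P by (simp add: batch_partitions_def)
    then show ?case by blast
  qed
  then show ?thesis by (simp add: N)
qed

text \<open>The canonical model: independent uniform partitions exist for every \<open>N\<close> divisible by \<open>p\<close>.\<close>

lemma random_divisions_canonical:
  assumes "p > 0" "p dvd N"
  shows "random_divisions (PiM UNIV (\<lambda>_::nat. uniform_count_measure (batch_partitions p N)))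
           p N (\<lambda>k \<omega>. \<omega> k)"
proof -
  let ?P = "batch_partitions p N"
  let ?U = "uniform_count_measure ?P"
  let ?M = "PiM UNIV (\<lambda>_::nat. ?U)"
  have sets: "sets ?U = sets (count_space ?P)" by (simp add: sets_uniform_count_measure)
  interpret U: prob_space ?U
    using prob_space_uniform_count_measure finite_batch_partitions
      batch_partitions_nonempty[OF assms] by blast
  interpret pp: product_prob_space "\<lambda>_::nat. ?U" UNIV ..
  have comp: "distr ?M (count_space ?P) (\<lambda>\<omega>. \<omega> k) = ?U" for k
  proof -
    have "distr ?M (count_space ?P) (\<lambda>\<omega>. \<omega> k) = distr ?M ?U (\<lambda>\<omega>. \<omega> k)"
      by (rule distr_cong) (simp_all add: sets)
    also have "\<dots> = ?U" by (rule pp.PiM_component) simp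
    finally show ?thesis .
  qed
  have rv: "(\<lambda>\<omega>. \<omega> k) \<in> measurable ?M (count_space ?P)" for k
    using measurable_component_singleton[of k UNIV "\<lambda>_. ?U"] measurable_cong_sets[OF refl sets]
    by blast
  have "distr ?M (PiM UNIV (\<lambda>_. count_space ?P)) (\<lambda>\<omega>. \<lambda>k\<in>UNIV. \<omega> k) = distr ?M ?M (\<lambda>\<omega>. \<omega>)"
    by (rule distr_cong) (auto intro!: sets_PiM_cong simp: sets)
  also have "\<dots> = PiM UNIV (\<lambda>k. distr ?M (count_space ?P) (\<lambda>\<omega>. \<omega> k))"
    by (simp add: distr_id comp)
  finally have "pp.P.indep_vars (\<lambda>_. count_space ?P) (\<lambda>k \<omega>. \<omega> k) UNIV"
    using rv by (subst pp.P.indep_vars_iff_distr_eq_PiM) auto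
  then show ?thesis
    using comp by unfold_locales auto
qed

end

theory Submission
  imports Defs "HOL-Combinatorics.Permutations" "HOL-Real_Asymp.Real_Asymp"
begin

text \<open>
  By symmetry under transpositions, two distinct particles share a batch with probability at
  most \<open>\<delta> = p / (N - 1)\<close>. The last partition is independent of the preceding
  ones and involves at most \<open>p\<^sup>2\<close> pairs of predecessors, so a union bound over these
  pairs shows that the probability \<open>q\<^sub>k\<close> of two lineages meeting satisfies
  \<open>q\<^bsub>k+1\<^esub> \<le> \<delta> + p\<^sup>2 q\<^sub>k\<close>; in the same way
  \<open>\<epsilon>\<^bsub>k+1\<^esub> \<le> p \<epsilon>\<^sub>k + p\<^sup>2 q\<^sub>k\<close>. Here \<open>q\<^sub>k\<close> and \<open>\<epsilon>\<^sub>k\<close>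
  are taken uniformly over particles, so that exchangeability of the whole process is not needed.
  Hence \<open>\<epsilon>\<^sub>k \<le> k\<^sup>2 p\<^bsup>2k\<^esup> \<delta>\<close>, which vanishes as \<open>N \<rightarrow> \<infinity>\<close>.
\<close>

section \<open>Batches of a fixed partition\<close>

lemma batch_of_eq:
  assumes "P \<in> batch_partitions p N" "B \<in> P" "i \<in> B"
  shows "batch_of P i = B"
  unfolding batch_of_def
proof (rule the_equality)
  show "B' = B" if "B' \<in> P \<and> i \<in> B'" for B'
    using assms that by (auto simp: batch_partitions_def partition_on_def disjoint_def)
qed (use assms in simp)

lemma batch_of_partition:
  assumes "P \<in> batch_partitions p N" "i \<in> {1..N}"
  shows "batch_of P i \<in> P" "i \<in> batch_of P i"
    "batch_of P i \<subseteq> {1..N}" "card (batch_of P i) = p"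
proof -
  have "i \<in> \<Union>P" using assms by (simp add: batch_partitions_def partition_on_def)
  then obtain B where B: "B \<in> P" "i \<in> B" by blast
  then have "batch_of P i = B" using batch_of_eq assms(1) by blast
  then show "batch_of P i \<in> P" "i \<in> batch_of P i"
    "batch_of P i \<subseteq> {1..N}" "card (batch_of P i) = p"
    using B assms(1) by (auto simp: batch_partitions_def partition_on_def)
qed

text \<open>Replaces the definite description in \<open>batch_of\<close> by an existential, in which
  membership can be transported to the image of a partition under a relabelling.\<close>

lemma mem_batch_of_iff:
  assumes "P \<in> batch_partitions p N" "i \<in> {1..N}"
  shows "j \<in> batch_of P i \<longleftrightarrow> (\<exists>B\<in>P. i \<in> B \<and> j \<in> B)"
  using batch_of_partition[OF assms] batch_of_eq[OF assms(1)] by blast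

section \<open>Symmetry and counting of partitions\<close>

lemma batch_partitions_image:
  assumes "P \<in> batch_partitions p N" "f permutes {1..N}"
  shows "(`) f ` P \<in> batch_partitions p N"
proof -
  have inj: "inj f" using assms(2) by (rule permutes_inj)
  have part: "partition_on {1..N} P" and card: "\<And>B. B \<in> P \<Longrightarrow> card B = p"
    using assms(1) by (auto simp: batch_partitions_def)
  have "partition_on (f ` {1..N}) ((`) f ` P)"
  proof (rule partition_onI)
    show "\<Union> ((`) f ` P) = f ` {1..N}"
      using part by (auto simp: partition_on_def)
    show "disjnt B B'" if "B \<in> (`) f ` P" "B' \<in> (`) f ` P" "B \<noteq> B'" for B B'
      using that part inj by (auto simp: partition_on_def disjnt_def disjoint_def inj_def) blast+
    show "{} \<notin> (`) f ` P" using part by (auto simp: partition_on_def)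
  qed
  moreover have "card B = p" if "B \<in> (`) f ` P" for B
    using that card inj by (auto simp: card_image inj_on_subset)
  ultimately show ?thesis
    using permutes_image[OF assms(2)] by (simp add: batch_partitions_def)
qed

text \<open>The transposition of \<open>j\<close> and \<open>l\<close> fixes \<open>i\<close>, so
  relabelling by it sends partitions in which \<open>j\<close> joins \<open>i\<close> to partitions
  in which \<open>l\<close> joins \<open>i\<close>, injectively. One inequality suffices for the
  averaging below; exchanging \<open>j\<close> and \<open>l\<close> would give equality.\<close>

lemma card_same_batch_le:
  assumes "i \<in> {1..N}" "j \<in> {1..N}" "l \<in> {1..N}" "j \<noteq> i" "l \<noteq> i"
  shows "card {P \<in> batch_partitions p N. j \<in> batch_of P i}
       \<le> card {P \<in> batch_partitions p N. l \<in> batch_of P i}"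
proof (rule card_inj_on_le)
  let ?t = "Transposition.transpose j l"
  have perm: "?t permutes {1..N}" using assms by (simp add: permutes_swap_id)
  show "inj_on ((`) ((`) ?t)) {P \<in> batch_partitions p N. j \<in> batch_of P i}"
    \<comment> \<open>A transposition is an involution, so the induced map on partitions is its own
      inverse.\<close>
    by (rule inj_on_inverseI[where g = "(`) ((`) ?t)"]) (simp add: image_image)
  show "(`) ((`) ?t) ` {P \<in> batch_partitions p N. j \<in> batch_of P i}
      \<subseteq> {P \<in> batch_partitions p N. l \<in> batch_of P i}"
  proof clarsimp
    fix P assume P: "P \<in> batch_partitions p N" and j: "j \<in> batch_of P i"
    have P': "(`) ?t ` P \<in> batch_partitions p N" using P perm by (rule batch_partitions_image)
    have "?t i \<in> ?t ` batch_of P i" "?t j \<in> ?t ` batch_of P i"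
      using batch_of_partition(2)[OF P assms(1)] j by (auto intro: imageI simp del: transpose_apply_first)
    \<comment> \<open>\<open>i\<close> is fixed because it differs from both \<open>j\<close> and
      \<open>l\<close>, while \<open>j\<close> is sent to \<open>l\<close>.\<close>
    then have "i \<in> ?t ` batch_of P i" "l \<in> ?t ` batch_of P i" using assms by auto
    then have "l \<in> batch_of ((`) ?t ` P) i"
      using mem_batch_of_iff[OF P' assms(1)] batch_of_partition(1)[OF P assms(1)] by blast
    then show "(`) ?t ` P \<in> batch_partitions p N \<and> l \<in> batch_of ((`) ?t ` P) i" using P' by simp
  qed
qed (simp add: finite_batch_partitions)

lemma sum_card_Collect_swap:
  assumes "finite S" "finite T"
  shows "(\<Sum>s\<in>S. card {t \<in> T. R s t}) = (\<Sum>t\<in>T. card {s \<in> S. R s t})"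
  unfolding card_eq_sum using assms by (rule sum.swap_restrict)

text \<open>Averaging over all possible companions of \<open>i\<close>: each of the
  \<open>N - 1\<close> candidates accounts for at least as many partitions as \<open>j\<close>, and
  by double counting each partition contributes at most a batch size to the total. The form without
  division becomes the bound \<open>p / (N - 1)\<close> on the probability of a shared
  batch.\<close>

lemma card_same_batch_bound:
  assumes "i \<in> {1..N}" "j \<in> {1..N}" "j \<noteq> i"
  shows "(N - 1) * card {P \<in> batch_partitions p N. j \<in> batch_of P i}
       \<le> p * card (batch_partitions p N)"
proof -
  let ?BP = "batch_partitions p N"
  have "(N - 1) * card {P \<in> ?BP. j \<in> batch_of P i}
      = (\<Sum>l\<in>{1..N} - {i}. card {P \<in> ?BP. j \<in> batch_of P i})"
    using assms(1) by simp
  also have "\<dots> \<le> (\<Sum>l\<in>{1..N} - {i}. card {P \<in> ?BP. l \<in> batch_of P i})"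
    using assms by (intro sum_mono card_same_batch_le) auto
  also have "\<dots> = (\<Sum>P\<in>?BP. card {l \<in> {1..N} - {i}. l \<in> batch_of P i})"
    by (rule sum_card_Collect_swap) (simp_all add: finite_batch_partitions)
  \<comment> \<open>Only \<open>p - 1\<close> companions exist; the cruder \<open>p\<close> changes
    nothing in the limit.\<close>
  also have "\<dots> \<le> (\<Sum>P\<in>?BP. p)"
  proof (rule sum_mono)
    fix P assume P: "P \<in> ?BP"
    have "card {l \<in> {1..N} - {i}. l \<in> batch_of P i} \<le> card (batch_of P i)"
      using finite_subset[OF batch_of_partition(3)[OF P assms(1)]] by (intro card_mono) auto
    then show "card {l \<in> {1..N} - {i}. l \<in> batch_of P i} \<le> p"
      using batch_of_partition(4)[OF P assms(1)] by simp
  qed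
  finally show ?thesis by (simp add: mult.commute)
qed

lemma card_batch_pairs_le:
  assumes "P \<in> batch_partitions p N" "i \<in> {1..N}" "j \<in> {1..N}"
  shows "card {s \<in> S. fst s \<in> batch_of P i \<and> snd s \<in> batch_of P j} \<le> p\<^sup>2"
proof -
  have "card {s \<in> S. fst s \<in> batch_of P i \<and> snd s \<in> batch_of P j}
      \<le> card (batch_of P i \<times> batch_of P j)"
    using batch_of_partition(3)[OF assms(1)] assms(2,3)
    by (intro card_mono) (auto intro: finite_subset)
  then show ?thesis
    using batch_of_partition(4)[OF assms(1)] assms(2,3)
    by (simp add: card_cartesian_product power2_eq_square)
qed

section \<open>Dependence on earlier partitions only\<close>

text \<open>Together with \<open>clean_cong\<close>, this makes the state after \<open>k\<close>
  divisions a function of the partitions with index below \<open>k\<close>, and hence independent of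
  the partition with index \<open>k\<close>.\<close>

lemma lineage_cong:
  "(\<And>n. n < k \<Longrightarrow> D n = D' n) \<Longrightarrow> lineage D k = lineage D' k"
  by (induction k) (simp_all add: fun_eq_iff)

lemma clean_cong:
  assumes "\<And>n. n < k \<Longrightarrow> D n = D' n"
  shows "clean N D k = clean N D' k"
  using assms
proof (induction k)
  case (Suc k)
  then have "clean N D k = clean N D' k" "lineage D k = lineage D' k"
    by (auto intro!: lineage_cong)
  with Suc.prems[of k] show ?case by simp
qed simp

section \<open>Independence and a refined union bound\<close>

context random_divisions
begin

lemma C_in_partitions: "\<omega> \<in> space M \<Longrightarrow> C k \<omega> \<in> batch_partitions p N"
  using indep measurable_space[of "C k" M "count_space (batch_partitions p N)" \<omega>]
  by (simp add: indep_vars_def)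

lemma prob_C:
  "prob {\<omega> \<in> space M. R (C k \<omega>)}
     = card {P \<in> batch_partitions p N. R P} / card (batch_partitions p N)"
proof -
  let ?S = "{P \<in> batch_partitions p N. R P}"
  have rv: "C k \<in> measurable M (count_space (batch_partitions p N))"
    using indep by (simp add: indep_vars_def)
  have "{\<omega> \<in> space M. R (C k \<omega>)} = C k -` ?S \<inter> space M"
    using C_in_partitions by auto
  then have "prob {\<omega> \<in> space M. R (C k \<omega>)}
      = measure (distr M (count_space (batch_partitions p N)) (C k)) ?S"
    using rv by (simp add: measure_distr)
  then show ?thesis
    unfolding uniform by (simp add: measure_uniform_count_measure finite_batch_partitions)
qed

text \<open>A predicate that looks only at indices below \<open>k\<close> is a predicate of a finite
  block of partitions, and this block is independent of \<open>C k\<close>. The first claim, used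
  with \<open>Suc k\<close> in place of \<open>k\<close>, also yields measurability of the events
  that involve \<open>C k\<close>.\<close>

lemma prob_prefix_event:
  assumes "\<And>D D'. (\<And>n. n < k \<Longrightarrow> D n = D' n) \<Longrightarrow> Q D = Q D'"
  shows "{\<omega> \<in> space M. Q (\<lambda>n. C n \<omega>)} \<in> events"
    and "prob {\<omega> \<in> space M. R (C k \<omega>) \<and> Q (\<lambda>n. C n \<omega>)}
       = prob {\<omega> \<in> space M. R (C k \<omega>)} * prob {\<omega> \<in> space M. Q (\<lambda>n. C n \<omega>)}"
proof -
  let ?BP = "batch_partitions p N"
  let ?X = "\<lambda>A \<omega>. restrict (\<lambda>n. C n \<omega>) A"
  define EQ where "EQ = {D \<in> PiE {..<k} (\<lambda>_. ?BP). Q D}"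
  define ER where "ER = {D \<in> PiE {k} (\<lambda>_. ?BP). R (D k)}"
  \<comment> \<open>A finite product of finite discrete spaces is discrete, so \<open>EQ\<close> and
    \<open>ER\<close> are measurable whatever \<open>Q\<close> and \<open>R\<close> are.\<close>
  have PiM: "PiM A (\<lambda>_. count_space ?BP) = count_space (PiE A (\<lambda>_. ?BP))"
    if "finite A" for A :: "nat set"
    using that by (intro count_space_PiM_finite) (auto intro: countable_finite finite_batch_partitions)
  have ind: "indep_var (PiM {k} (\<lambda>_. count_space ?BP)) (?X {k})
      (PiM {..<k} (\<lambda>_. count_space ?BP)) (?X {..<k})"
    using indep by (rule indep_var_restrict) auto
  have sets: "EQ \<in> sets (PiM {..<k} (\<lambda>_. count_space ?BP))"
    "ER \<in> sets (PiM {k} (\<lambda>_. count_space ?BP))"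
    by (auto simp: PiM EQ_def ER_def)
  \<comment> \<open>The restriction is \<open>undefined\<close> from index \<open>k\<close> on,
    where \<open>Q\<close> does not look.\<close>
  have "Q (?X {..<k} \<omega>) = Q (\<lambda>n. C n \<omega>)" for \<omega>
    by (rule assms) simp
  then have vQ: "{\<omega> \<in> space M. Q (\<lambda>n. C n \<omega>)} = ?X {..<k} -` EQ \<inter> space M"
    by (auto simp: EQ_def C_in_partitions)
  have vR: "{\<omega> \<in> space M. R (C k \<omega>)} = ?X {k} -` ER \<inter> space M"
    by (auto simp: ER_def C_in_partitions)
  show "{\<omega> \<in> space M. Q (\<lambda>n. C n \<omega>)} \<in> events"
    unfolding vQ using indep_var_rv2[OF ind] sets(1) by (rule measurable_sets)
  have "{\<omega> \<in> space M. R (C k \<omega>) \<and> Q (\<lambda>n. C n \<omega>)}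
      = (\<lambda>\<omega>. (?X {k} \<omega>, ?X {..<k} \<omega>)) -` (ER \<times> EQ) \<inter> space M"
    using vQ vR by auto
  then show "prob {\<omega> \<in> space M. R (C k \<omega>) \<and> Q (\<lambda>n. C n \<omega>)}
      = prob {\<omega> \<in> space M. R (C k \<omega>)} * prob {\<omega> \<in> space M. Q (\<lambda>n. C n \<omega>)}"
    unfolding vQ vR using indep_varD[OF ind sets(2,1)] by simp
qed

text \<open>The index set \<open>S\<close> may grow with \<open>N\<close>, but each value of
  \<open>C k\<close> activates at most \<open>c\<close> indices. By independence the sum of the
  probabilities is at most \<open>q\<close> times the expected number of active indices, hence at
  most \<open>c * q\<close>, with no factor \<open>card S\<close>.\<close>

lemma union_bound:
  assumes "finite S"
    and dep: "\<And>s D D'. (\<And>n. n < k \<Longrightarrow> D n = D' n) \<Longrightarrow> Q s D = Q s D'"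
    and card: "\<And>P. P \<in> batch_partitions p N \<Longrightarrow> card {s \<in> S. R s P} \<le> c"
    and q: "\<And>s. s \<in> S \<Longrightarrow> prob {\<omega> \<in> space M. Q s (\<lambda>n. C n \<omega>)} \<le> q" "q \<ge> 0"
  shows "prob {\<omega> \<in> space M. \<exists>s\<in>S. R s (C k \<omega>) \<and> Q s (\<lambda>n. C n \<omega>)} \<le> c * q"
proof -
  let ?BP = "batch_partitions p N"
  let ?E = "\<lambda>s. {\<omega> \<in> space M. R s (C k \<omega>) \<and> Q s (\<lambda>n. C n \<omega>)}"
  have ev: "?E s \<in> events" for s
  proof (rule prob_prefix_event(1)[of "Suc k" "\<lambda>D. R s (D k) \<and> Q s D"])
    show "(R s (D k) \<and> Q s D) \<longleftrightarrow> (R s (D' k) \<and> Q s D')"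
      if "\<And>n. n < Suc k \<Longrightarrow> D n = D' n" for D D'
      using that dep[of D D' s] by simp
  qed
  have "prob {\<omega> \<in> space M. \<exists>s\<in>S. R s (C k \<omega>) \<and> Q s (\<lambda>n. C n \<omega>)} = prob (\<Union>s\<in>S. ?E s)"
    by (rule arg_cong[where f = prob]) auto
  also have "\<dots> \<le> (\<Sum>s\<in>S. prob (?E s))"
    using assms(1) ev by (intro finite_measure_subadditive_finite) auto
  also have "\<dots> \<le> (\<Sum>s\<in>S. card {P \<in> ?BP. R s P} / card ?BP * q)"
  proof (rule sum_mono)
    fix s assume "s \<in> S"
    have "prob (?E s) = prob {\<omega> \<in> space M. R s (C k \<omega>)} * prob {\<omega> \<in> space M. Q s (\<lambda>n. C n \<omega>)}"
      by (rule prob_prefix_event(2)) (rule dep)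
    also have "prob {\<omega> \<in> space M. R s (C k \<omega>)} = card {P \<in> ?BP. R s P} / card ?BP"
      by (rule prob_C)
    finally show "prob (?E s) \<le> card {P \<in> ?BP. R s P} / card ?BP * q"
      using mult_left_mono[OF q(1)[OF \<open>s \<in> S\<close>], of "card {P \<in> ?BP. R s P} / card ?BP"] by simp
  qed
  also have "\<dots> = real (\<Sum>s\<in>S. card {P \<in> ?BP. R s P}) / card ?BP * q"
    by (simp only: of_nat_sum sum_distrib_right sum_divide_distrib)
  \<comment> \<open>Double counting turns the sum of the activation probabilities into the mean
    number of active indices.\<close>
  also have "\<dots> = real (\<Sum>P\<in>?BP. card {s \<in> S. R s P}) / card ?BP * q"
    by (simp only: sum_card_Collect_swap[OF assms(1) finite_batch_partitions])
  also have "\<dots> \<le> real (\<Sum>P\<in>?BP. c) / card ?BP * q"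
    by (intro mult_right_mono divide_right_mono of_nat_mono sum_mono card q(2) of_nat_0_le_iff)
  \<comment> \<open>For a zero denominator the quotient is 0 by convention, and the bound still
    holds since \<open>q\<close> is nonnegative.\<close>
  also have "\<dots> \<le> c * q"
    using q(2) by (cases "card ?BP = 0") auto
  finally show ?thesis .
qed

section \<open>Probability bounds for shared batches and meeting lineages\<close>

lemma prob_same_batch_le:
  assumes "i \<in> {1..N}" "j \<in> {1..N}" "j \<noteq> i"
  shows "prob {\<omega> \<in> space M. j \<in> batch_of (C k \<omega>) i} \<le> p / (real N - 1)"
proof -
  let ?c = "card (batch_partitions p N)" and ?d = "card {P \<in> batch_partitions p N. j \<in> batch_of P i}"
  have N: "real (N - 1) = real N - 1" "real N - 1 > 0" using assms by auto
  have "real (N - 1) * ?d \<le> real p * ?c"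
    using card_same_batch_bound[OF assms, of p] unfolding of_nat_mult[symmetric] of_nat_le_iff .
  then have "?d * (real N - 1) \<le> p * ?c" unfolding N(1) of_nat_mult by (simp only: mult.commute)
  then have "?d / ?c \<le> p / (real N - 1)"
    using N(2) by (cases "?c = 0") (auto simp: divide_simps)
  then show ?thesis by (subst prob_C)
qed

text \<open>Serves both inductions: distinct \<open>i\<close> and \<open>j\<close> give collisions
  between the predecessors of two particles, and \<open>i = j\<close> gives collisions inside one
  batch. At most \<open>p\<^sup>2\<close> pairs are active for each partition, whatever
  \<open>N\<close> is.\<close>

lemma batch_pairs_meet:
  assumes "i \<in> {1..N}" "j \<in> {1..N}" "q \<ge> 0"
    and q: "\<forall>a\<in>{1..N}. \<forall>b\<in>{1..N}. a \<noteq> b \<longrightarrow>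
      prob {\<omega> \<in> space M. lineage (\<lambda>n. C n \<omega>) k a \<inter> lineage (\<lambda>n. C n \<omega>) k b \<noteq> {}} \<le> q"
  defines "E \<equiv> {\<omega> \<in> space M. \<exists>s\<in>{s \<in> {1..N} \<times> {1..N}. fst s \<noteq> snd s}.
      (fst s \<in> batch_of (C k \<omega>) i \<and> snd s \<in> batch_of (C k \<omega>) j)
      \<and> lineage (\<lambda>n. C n \<omega>) k (fst s) \<inter> lineage (\<lambda>n. C n \<omega>) k (snd s) \<noteq> {}}"
  shows "E \<in> events" and "prob E \<le> real (p\<^sup>2) * q"
proof -
  let ?S = "{s \<in> {1..N} \<times> {1..N}. fst s \<noteq> snd s}"
  let ?meet = "\<lambda>s D. lineage D k (fst s) \<inter> lineage D k (snd s) \<noteq> {}"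
  have dep: "?meet s D = ?meet s D'" if "\<And>n. n < k \<Longrightarrow> D n = D' n" for s D D'
    using lineage_cong[OF that] by simp
  show "E \<in> events"
    unfolding E_def
  proof (rule prob_prefix_event(1)[of "Suc k"
      "\<lambda>D. \<exists>s\<in>?S. (fst s \<in> batch_of (D k) i \<and> snd s \<in> batch_of (D k) j) \<and> ?meet s D"])
    show "(\<exists>s\<in>?S. (fst s \<in> batch_of (D k) i \<and> snd s \<in> batch_of (D k) j) \<and> ?meet s D)
        \<longleftrightarrow> (\<exists>s\<in>?S. (fst s \<in> batch_of (D' k) i \<and> snd s \<in> batch_of (D' k) j) \<and> ?meet s D')"
      if "\<And>n. n < Suc k \<Longrightarrow> D n = D' n" for D D'
      using that lineage_cong[of k D D'] by simp
  qed
  show "prob E \<le> real (p\<^sup>2) * q"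
    unfolding E_def
  proof (rule union_bound[where Q = ?meet, OF _ dep])
    show "prob {\<omega> \<in> space M. ?meet s (\<lambda>n. C n \<omega>)} \<le> q" if "s \<in> ?S" for s
      using that q by auto
    show "card {s \<in> ?S. fst s \<in> batch_of P i \<and> snd s \<in> batch_of P j} \<le> p\<^sup>2"
      if "P \<in> batch_partitions p N" for P
      using that assms(1,2) by (rule card_batch_pairs_le)
  qed (use assms(3) in auto)
qed

text \<open>If two lineages meet after \<open>Suc k\<close> divisions, either the particles share
  the last batch or two distinct predecessors already had meeting lineages. The bound is chosen to
  absorb the resulting recursion; at \<open>k = 0\<close> lineages of distinct particles are
  disjoint singletons.\<close>

lemma prob_lineages_meet_le:
  assumes "i \<in> {1..N}" "j \<in> {1..N}" "i \<noteq> j" "p > 0"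
  shows "prob {\<omega> \<in> space M. lineage (\<lambda>n. C n \<omega>) k i \<inter> lineage (\<lambda>n. C n \<omega>) k j \<noteq> {}}
       \<le> k * p ^ (2 * k) * (p / (real N - 1))"
  using assms(1-3)
proof (induction k arbitrary: i j)
  case (Suc k)
  let ?L = "\<lambda>\<omega>. lineage (\<lambda>n. C n \<omega>)" and ?\<delta> = "p / (real N - 1)"
  let ?S = "{s \<in> {1..N} \<times> {1..N}. fst s \<noteq> snd s}"
  let ?E1 = "{\<omega> \<in> space M. j \<in> batch_of (C k \<omega>) i}"
  let ?E2 = "{\<omega> \<in> space M. \<exists>s\<in>?S. (fst s \<in> batch_of (C k \<omega>) i \<and> snd s \<in> batch_of (C k \<omega>) j)
    \<and> ?L \<omega> k (fst s) \<inter> ?L \<omega> k (snd s) \<noteq> {}}"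
  have \<delta>: "?\<delta> \<ge> 0" using Suc.prems by simp
  have ev1: "?E1 \<in> events"
    by (rule prob_prefix_event(1)[of "Suc k" "\<lambda>D. j \<in> batch_of (D k) i"]) simp
  have q0: "0 \<le> real (k * p ^ (2 * k)) * ?\<delta>"
    using \<delta> by (intro mult_nonneg_nonneg) simp_all
  have meet: "\<forall>a\<in>{1..N}. \<forall>b\<in>{1..N}. a \<noteq> b \<longrightarrow>
      prob {\<omega> \<in> space M. ?L \<omega> k a \<inter> ?L \<omega> k b \<noteq> {}} \<le> k * p ^ (2 * k) * ?\<delta>"
    using Suc.IH assms(4) by blast
  note E2 = batch_pairs_meet[OF Suc.prems(1,2) q0 meet]
  have sub: "{\<omega> \<in> space M. ?L \<omega> (Suc k) i \<inter> ?L \<omega> (Suc k) j \<noteq> {}} \<subseteq> ?E1 \<union> ?E2"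
  proof
    fix \<omega> assume "\<omega> \<in> {\<omega> \<in> space M. ?L \<omega> (Suc k) i \<inter> ?L \<omega> (Suc k) j \<noteq> {}}"
    then obtain a b where \<omega>: "\<omega> \<in> space M"
      and ab: "a \<in> batch_of (C k \<omega>) i" "b \<in> batch_of (C k \<omega>) j" "?L \<omega> k a \<inter> ?L \<omega> k b \<noteq> {}"
      by auto
    note P = C_in_partitions[OF \<omega>, of k]
    have "a \<in> {1..N}" "b \<in> {1..N}"
      using ab batch_of_partition(3)[OF P] Suc.prems by blast+
    \<comment> \<open>A common predecessor lies in the batches of both particles, so the two batches
      coincide.\<close>
    moreover have "j \<in> batch_of (C k \<omega>) i" if "a = b"
      using that ab Suc.prems batch_of_partition(1,2)[OF P] batch_of_eq[OF P] by metis
    ultimately show "\<omega> \<in> ?E1 \<union> ?E2" using \<omega> ab by (cases "a = b") force+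
  qed
  have "prob {\<omega> \<in> space M. ?L \<omega> (Suc k) i \<inter> ?L \<omega> (Suc k) j \<noteq> {}} \<le> prob (?E1 \<union> ?E2)"
    by (rule finite_measure_mono[OF sub sets.Un[OF ev1 E2(1)]])
  also have "\<dots> \<le> prob ?E1 + prob ?E2"
    using ev1 E2(1) by (rule measure_Un_le)
  also have "\<dots> \<le> ?\<delta> + real (p\<^sup>2) * (k * p ^ (2 * k) * ?\<delta>)"
    using Suc.prems E2(2) by (intro add_mono prob_same_batch_le) auto
  also have "\<dots> = (1 + k * real p ^ (2 * Suc k)) * ?\<delta>"
    by (simp add: algebra_simps power_add power2_eq_square)
  \<comment> \<open>The lone 1 is absorbed into one further copy of the power, which is at least 1
    because \<open>p\<close> is positive.\<close>
  also have "\<dots> \<le> (Suc k * real p ^ (2 * Suc k)) * ?\<delta>"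
    using \<delta> assms(4) one_le_power[of "real p" "2 * Suc k"] by (intro mult_right_mono) (auto simp: algebra_simps)
  finally show ?case by (simp only: of_nat_mult of_nat_power)
qed simp

section \<open>Probability of being dirty\<close>

text \<open>A particle becomes dirty through a dirty member of its batch (\<open>?E1\<close>) or
  through two members with meeting lineages (\<open>?E2\<close>). Quantifying over all
  \<open>i\<close> lets the induction hypothesis apply to every member of the batch.\<close>

lemma prob_dirty_le:
  assumes "i \<in> {1..N}" "p > 0" "N > 1"
  shows "prob {\<omega> \<in> space M. i \<notin> clean N (\<lambda>n. C n \<omega>) k} \<le> k\<^sup>2 * p ^ (2 * k) * (p / (real N - 1))"
  using assms(1)
proof (induction k arbitrary: i)
  case (Suc k)
  let ?L = "\<lambda>\<omega>. lineage (\<lambda>n. C n \<omega>)" and ?\<delta> = "p / (real N - 1)"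
  let ?S = "{s \<in> {1..N} \<times> {1..N}. fst s \<noteq> snd s}"
  let ?E1 = "{\<omega> \<in> space M. \<exists>j\<in>{1..N}. j \<in> batch_of (C k \<omega>) i \<and> j \<notin> clean N (\<lambda>n. C n \<omega>) k}"
  let ?E2 = "{\<omega> \<in> space M. \<exists>s\<in>?S. (fst s \<in> batch_of (C k \<omega>) i \<and> snd s \<in> batch_of (C k \<omega>) i)
    \<and> ?L \<omega> k (fst s) \<inter> ?L \<omega> k (snd s) \<noteq> {}}"
  have \<delta>: "?\<delta> \<ge> 0" using assms(3) by simp
  have ev1: "?E1 \<in> events"
  proof (rule prob_prefix_event(1)[of "Suc k" "\<lambda>D. \<exists>j\<in>{1..N}. j \<in> batch_of (D k) i \<and> j \<notin> clean N D k"])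
    show "(\<exists>j\<in>{1..N}. j \<in> batch_of (D k) i \<and> j \<notin> clean N D k)
        \<longleftrightarrow> (\<exists>j\<in>{1..N}. j \<in> batch_of (D' k) i \<and> j \<notin> clean N D' k)"
      if "\<And>n. n < Suc k \<Longrightarrow> D n = D' n" for D D'
      using that clean_cong[of k D D'] by simp
  qed
  have q0: "0 \<le> real (k * p ^ (2 * k)) * ?\<delta>"
    using \<delta> by (intro mult_nonneg_nonneg) simp_all
  have meet: "\<forall>a\<in>{1..N}. \<forall>b\<in>{1..N}. a \<noteq> b \<longrightarrow>
      prob {\<omega> \<in> space M. ?L \<omega> k a \<inter> ?L \<omega> k b \<noteq> {}} \<le> k * p ^ (2 * k) * ?\<delta>"
    using prob_lineages_meet_le assms(2) by blast
  note E2 = batch_pairs_meet[OF Suc.prems Suc.prems q0 meet]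
  \<comment> \<open>The union runs over all particles, but only the \<open>p\<close> members of the
    batch of \<open>i\<close> are active, so the factor is \<open>p\<close> rather than
    \<open>N\<close>.\<close>
  have E1: "prob ?E1 \<le> real p * (k\<^sup>2 * p ^ (2 * k) * ?\<delta>)"
  proof (rule union_bound[where Q = "\<lambda>j D. j \<notin> clean N D k"])
    show "j \<notin> clean N D k \<longleftrightarrow> j \<notin> clean N D' k"
      if "\<And>n. n < k \<Longrightarrow> D n = D' n" for j D D'
      using clean_cong[OF that] by simp
    show "card {j \<in> {1..N}. j \<in> batch_of P i} \<le> p" if P: "P \<in> batch_partitions p N" for P
    proof -
      have "{j \<in> {1..N}. j \<in> batch_of P i} = batch_of P i"
        using batch_of_partition(3)[OF P Suc.prems] by blast
      then show ?thesis using batch_of_partition(4)[OF P Suc.prems] by simp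
    qed
    show "0 \<le> real (k\<^sup>2 * p ^ (2 * k)) * ?\<delta>"
      using \<delta> by (intro mult_nonneg_nonneg) simp_all
  qed (use Suc.IH in simp_all)
  have sub: "{\<omega> \<in> space M. i \<notin> clean N (\<lambda>n. C n \<omega>) (Suc k)} \<subseteq> ?E1 \<union> ?E2"
  proof
    fix \<omega> assume "\<omega> \<in> {\<omega> \<in> space M. i \<notin> clean N (\<lambda>n. C n \<omega>) (Suc k)}"
    then have \<omega>: "\<omega> \<in> space M" and i: "i \<notin> clean N (\<lambda>n. C n \<omega>) (Suc k)" by auto
    have "batch_of (C k \<omega>) i \<subseteq> {1..N}"
      using C_in_partitions[OF \<omega>] Suc.prems by (rule batch_of_partition(3))
    with i Suc.prems \<omega> show "\<omega> \<in> ?E1 \<union> ?E2" by simp (metis atLeastAtMost_iff subsetD)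
  qed
  have "prob {\<omega> \<in> space M. i \<notin> clean N (\<lambda>n. C n \<omega>) (Suc k)} \<le> prob (?E1 \<union> ?E2)"
    by (rule finite_measure_mono[OF sub sets.Un[OF ev1 E2(1)]])
  also have "\<dots> \<le> prob ?E1 + prob ?E2"
    using ev1 E2(1) by (rule measure_Un_le)
  also have "\<dots> \<le> real p * (k\<^sup>2 * p ^ (2 * k) * ?\<delta>) + real (p\<^sup>2) * (k * p ^ (2 * k) * ?\<delta>)"
    using E1 E2(2) by (rule add_mono)
  also have "\<dots> = real (p * k\<^sup>2 + p\<^sup>2 * k) * (p ^ (2 * k) * ?\<delta>)"
    by (simp add: algebra_simps)
  \<comment> \<open>The factor \<open>k\<^sup>2\<close> arises from adding a collision term linear
    in \<open>k\<close> at each step: \<open>k\<^sup>2 + k\<close> is at most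
    \<open>(Suc k)\<^sup>2\<close>.\<close>
  also have "\<dots> \<le> real ((Suc k)\<^sup>2 * p\<^sup>2) * (p ^ (2 * k) * ?\<delta>)"
  proof (intro mult_right_mono of_nat_mono)
    have "p * k\<^sup>2 \<le> p\<^sup>2 * k\<^sup>2" using assms(2) by (simp add: power2_eq_square)
    then have "p * k\<^sup>2 + p\<^sup>2 * k \<le> p\<^sup>2 * k\<^sup>2 + p\<^sup>2 * k" by simp
    also have "\<dots> \<le> (Suc k)\<^sup>2 * p\<^sup>2"
      by (simp add: power2_eq_square algebra_simps)
    finally show "p * k\<^sup>2 + p\<^sup>2 * k \<le> (Suc k)\<^sup>2 * p\<^sup>2" .
  qed (intro mult_nonneg_nonneg \<delta> of_nat_0_le_iff)
  also have "\<dots> = real ((Suc k)\<^sup>2 * p\<^sup>2 * p ^ (2 * k)) * ?\<delta>"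
    by (simp only: of_nat_mult of_nat_power mult.assoc)
  also have "(Suc k)\<^sup>2 * p\<^sup>2 * p ^ (2 * k) = (Suc k)\<^sup>2 * p ^ (2 * Suc k)"
    by (simp only: mult_Suc_right power_add mult.assoc)
  finally show ?case .
qed simp

end

section \<open>Passage to the limit along the multiples of \<open>p\<close>\<close>

theorem theorem3p2:
  fixes p k :: nat
    and M :: "nat \<Rightarrow> 'a measure"
    and C :: "nat \<Rightarrow> nat \<Rightarrow> 'a \<Rightarrow> nat set set"
  assumes "p \<ge> 2"
    and "\<And>N. N > 0 \<Longrightarrow> p dvd N \<Longrightarrow> random_divisions (M N) p N (C N)"
  shows "((\<lambda>N. dirty_prob (M N) N (C N) k) \<longlongrightarrow> 0) (inf at_top (principal {N. p dvd N}))"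
proof (rule tendsto_sandwich)
  let ?u = "\<lambda>N. k\<^sup>2 * p ^ (2 * k) * (p / (real N - 1))"
  show "\<forall>\<^sub>F N in inf at_top (principal {N. p dvd N}). 0 \<le> dirty_prob (M N) N (C N) k"
    by (simp add: dirty_prob_def)
  show "\<forall>\<^sub>F N in inf at_top (principal {N. p dvd N}). dirty_prob (M N) N (C N) k \<le> ?u N"
    unfolding eventually_inf_principal
    \<comment> \<open>\<open>N > 1\<close> makes the denominator \<open>N - 1\<close> positive and
      places particle 1 in the range.\<close>
    using eventually_gt_at_top[of 1]
  proof eventually_elim
    case (elim N)
    show ?case
    proof
      assume "N \<in> {N. p dvd N}"
      then interpret random_divisions "M N" p N "C N" using assms(2) elim by simp
      show "dirty_prob (M N) N (C N) k \<le> ?u N"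
        unfolding dirty_prob_def using assms(1) elim by (intro prob_dirty_le) auto
    qed
  qed
  \<comment> \<open>For fixed \<open>p\<close> and \<open>k\<close> the bound is a constant over
    \<open>N - 1\<close>. It vanishes along all \<open>N\<close>, hence along the finer filter of
    multiples of \<open>p\<close>.\<close>
  have "?u \<longlonglongrightarrow> 0" by real_asymp
  then show "(?u \<longlongrightarrow> 0) (inf at_top (principal {N. p dvd N}))"
    by (rule tendsto_mono[OF inf_le1])
qed simp

end
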